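(* Let $N\ge 1$ be an integer and let $\mathcal{M}\subseteq M_{2^N}(\mathbb{C})$. The Lie subgroup $\mathcal{M}\mathrm{SU}(2^N) := \{A \in \mathrm{SU}(2^N) : AB = BA \ \text{for all } B \in \mathcal{M}\}$ is connected in each of the following cases: (i) $\mathcal{M}$ is a (not necessarily finite) set of pairwise commuting and diagonalizable matrices; (ii) $\mathcal{M}=\{U_\alpha : \alpha\in G\}$ is the set of matrices of the representation of a permutation group $G\le S_N$ acting on $N$ qubits.
   Context: $M_{2^N}(\mathbb{C})$ is the set of $2^N\times 2^N$ complex matrices; $\mathrm{SU}(2^N)$ is the group of unitary $2^N\times 2^N$ matrices of determinant one. Let $\sigma_0$ be the $2\times2$ identity matrix and $\sigma_1,\sigma_2,\sigma_3$ the usual Pauli matrices; $\otimes$ is the Kronecker product. For a permutation $\alpha$ of $\{1,\dots,N\}$, $U_\alpha\in U(2^N)$ is the permutation matrix that permutes the tensor factors of $(\mathbb{C}^2)^{\otimes N}$: $U_\alpha(v^{(1)}\otimes\cdots\otimes v^{(N)}) = v^{(\alpha(1))}\otimes\cdots\otimes v^{(\alpha(N))}$ for all $v^{(1)},\dots,v^{(N)}\in\mathbb{C}^2$; it satisfies $U_\alpha(\sigma_{\mu_1}\otimes\cdots\otimes\sigma_{\mu_N})U_\alpha^\dagger=\sigma_{\mu_{\alpha(1)}}\otimes\cdots\otimes\sigma_{\mu_{\alpha(N)}}$ for all $\mu_1,\dots,\mu_N\in\{0,1,2,3\}$.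
   Formalization: In (i), "diagonalizable" means diagonalizable by a unitary change of basis (i.e. normal); with arbitrary changes of basis the claim fails: for N=1 and M={[[1,1],[0,2]]} the subgroup is {I,-I}, which is disconnected. *)

theory Defs
  imports "HOL-Analysis.Analysis" "HOL-Algebra.Bij"
begin

text \<open>
  The number of qubits \<open>N \<ge> 1\<close> is \<open>CARD('n)\<close> for a finite type \<open>'n\<close> that labels the qubits.
  The standard basis of the \<open>N\<close>-fold tensor power of \<open>complex ^ 2\<close> is indexed by the functions
  \<open>'n \<Rightarrow> 2\<close>, of which there are \<open>2 ^ N\<close>.
\<close>

type_synonym 'n qmat = "complex ^ ('n \<Rightarrow> 2) ^ ('n \<Rightarrow> 2)"

definition adj_matrix :: "complex ^ 'm ^ 'k \<Rightarrow> complex ^ 'k ^ 'm" where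
  "adj_matrix A = (\<chi> i j. cnj (A $ j $ i))"

definition unitary_matrix :: "complex ^ 'm ^ 'm \<Rightarrow> bool" where
  "unitary_matrix A \<longleftrightarrow> adj_matrix A ** A = mat 1 \<and> A ** adj_matrix A = mat 1"

definition SU :: "(complex ^ 'm ^ 'm) set" where
  "SU = {A. unitary_matrix A \<and> det A = 1}"

definition SU_commutant :: "(complex ^ 'm ^ 'm) set \<Rightarrow> (complex ^ 'm ^ 'm) set" where
  "SU_commutant M = {A \<in> SU. \<forall>B\<in>M. A ** B = B ** A}"

definition diagonal_matrix :: "complex ^ 'm ^ 'm \<Rightarrow> bool" where
  "diagonal_matrix D \<longleftrightarrow> (\<forall>i j. i \<noteq> j \<longrightarrow> D $ i $ j = 0)"

text \<open>
  Diagonalizability is by a unitary change of basis. With arbitrary invertible changes of basis,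
  the commutant need not be connected: the matrix with rows \<open>(1, 1)\<close> and \<open>(0, 2)\<close> is similar to
  a diagonal one, but commutes with no elements of \<open>SU(2)\<close> other than plus and minus the identity.
\<close>

definition unitarily_diagonalizable :: "complex ^ 'm ^ 'm \<Rightarrow> bool" where
  "unitarily_diagonalizable A \<longleftrightarrow>
     (\<exists>V D. unitary_matrix V \<and> diagonal_matrix D \<and> A = V ** D ** adj_matrix V)"

definition tensor :: "('n::finite \<Rightarrow> complex ^ 2) \<Rightarrow> complex ^ ('n \<Rightarrow> 2)" where
  "tensor v = (\<chi> s. \<Prod>i\<in>UNIV. v i $ s i)"

definition qubit_perm :: "('n::finite \<Rightarrow> 'n) \<Rightarrow> 'n qmat" where
  "qubit_perm \<alpha> = (\<chi> s t. if s = t \<circ> \<alpha> then 1 else 0)"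

text \<open>
  The two lemmas below confirm that \<open>qubit_perm \<alpha>\<close> is the only matrix that sends the tensor product
  of the vectors \<open>v i\<close> to that of the vectors \<open>v (\<alpha> i)\<close>, for all \<open>v\<close>.
\<close>

lemma qubit_perm_tensor:
  fixes \<alpha> :: "'n::finite \<Rightarrow> 'n"
  assumes "bij \<alpha>"
  shows "qubit_perm \<alpha> *v tensor v = tensor (v \<circ> \<alpha>)"
proof -
  have "(qubit_perm \<alpha> *v tensor v) $ s = tensor (v \<circ> \<alpha>) $ s" for s
  proof -
    have eq: "s = t \<circ> \<alpha> \<longleftrightarrow> t = s \<circ> inv_into UNIV \<alpha>" for t :: "'n \<Rightarrow> 2"
    proof
      assume "s = t \<circ> \<alpha>"
      then show "t = s \<circ> inv_into UNIV \<alpha>"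
        using assms by (simp add: fun_eq_iff bij_is_surj surj_f_inv_f)
    next
      assume "t = s \<circ> inv_into UNIV \<alpha>"
      then show "s = t \<circ> \<alpha>"
        using assms by (simp add: fun_eq_iff bij_is_inj)
    qed
    have "(qubit_perm \<alpha> *v tensor v) $ s = tensor v $ (s \<circ> inv_into UNIV \<alpha>)"
      by (simp add: matrix_vector_mult_def qubit_perm_def eq if_distrib[of "\<lambda>x. x * _"] cong: if_cong)
    also have "\<dots> = (\<Prod>i\<in>UNIV. v i $ s (inv_into UNIV \<alpha> i))"
      by (simp add: tensor_def)
    also have "\<dots> = (\<Prod>i\<in>UNIV. v (\<alpha> i) $ s i)"
      by (rule prod.reindex_bij_witness[of _ \<alpha> "inv_into UNIV \<alpha>"])
        (use assms in \<open>auto simp: bij_is_inj bij_is_surj surj_f_inv_f\<close>)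
    finally show ?thesis
      by (simp add: tensor_def)
  qed
  then show ?thesis
    by (simp add: vec_eq_iff)
qed

lemma qubit_perm_unique:
  fixes \<alpha> :: "'n::finite \<Rightarrow> 'n"
  assumes "bij \<alpha>" and A: "\<And>v. A *v tensor v = tensor (v \<circ> \<alpha>)"
  shows "A = qubit_perm \<alpha>"
proof -
  have axis: "axis t 1 = tensor (\<lambda>i. axis (t i) 1)" for t :: "'n \<Rightarrow> 2"
  proof -
    have "axis t 1 $ s = tensor (\<lambda>i. axis (t i) 1) $ s" for s
    proof (cases "s = t")
      case True
      then show ?thesis by (simp add: tensor_def axis_def)
    next
      case False
      then obtain i where "s i \<noteq> t i" by (auto simp: fun_eq_iff)
      then have "(\<Prod>i\<in>UNIV. axis (t i) (1::complex) $ s i) = 0"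
        by (intro prod_zero) (auto simp: axis_def)
      with False show ?thesis by (simp add: tensor_def axis_def)
    qed
    then show ?thesis by (simp only: vec_eq_iff) blast
  qed
  have entry: "B $ s $ t = (B *v axis t 1) $ s" for B :: "'n qmat" and s t
    by (simp add: matrix_vector_mult_def axis_def if_distrib[of "\<lambda>x. _ * x"] cong: if_cong)
  have "A $ s $ t = qubit_perm \<alpha> $ s $ t" for s t
    by (simp only: entry axis A qubit_perm_tensor[OF assms(1)])
  then show ?thesis
    by (simp only: vec_eq_iff) blast
qed

end

theory Submission
  imports Defs
begin

text \<open>
  The unitary matrices \<open>A\<close> commuting with \<open>M\<close> form a path connected set for every \<open>M\<close>: if \<open>- c\<close>, of
  modulus one, is not an eigenvalue of \<open>A\<close>, then the matrices \<open>(A + t c) (1 + t cnj c A)\<^sup>-\<^sup>1\<close>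
  for \<open>0 \<le> t \<le> 1\<close> join \<open>A\<close> to the scalar matrix \<open>c\<close> within this set.
  If a unit vector \<open>v\<close> is an eigenvector of each \<open>B\<close> in \<open>M\<close> and of its adjoint, with conjugate
  eigenvalues, then the projection \<open>P\<close> onto \<open>v\<close> commutes with \<open>M\<close>. As \<open>1 + (z - 1) P\<close> has
  determinant \<open>z\<close>, the map \<open>A \<mapsto> A (1 + (cnj (det A) - 1) P)\<close> is a continuous retraction
  onto the matrices of determinant one, which are therefore connected.
  Commuting normal matrices have such a \<open>v\<close>; for qubit permutations, take
  the basis vector with all qubits in state \<open>0\<close>.
\<close>

section \<open>Adjoints, scalar matrices and unitary matrices\<close>

lemma adj_matrix_mult: "adj_matrix (A ** B) = adj_matrix B ** adj_matrix A"
  by (simp add: adj_matrix_def matrix_matrix_mult_def vec_eq_iff mult.commute)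

lemma adj_matrix_adj_matrix [simp]: "adj_matrix (adj_matrix A) = A"
  by (simp add: adj_matrix_def vec_eq_iff)

lemma adj_matrix_mat [simp]: "adj_matrix (mat c) = mat (cnj c)"
  by (auto simp: adj_matrix_def mat_def vec_eq_iff)

lemma adj_matrix_add: "adj_matrix (A + B) = adj_matrix A + adj_matrix B"
  by (simp add: adj_matrix_def vec_eq_iff)

lemma det_adj_matrix: "det (adj_matrix A) = cnj (det A)"
proof -
  have "det (adj_matrix A) = det (\<chi> i j. cnj (A $ i $ j))"
    by (subst det_transpose[symmetric]) (simp add: adj_matrix_def transpose_def)
  also have "\<dots> = cnj (det A)"
    by (simp add: det_def)
  finally show ?thesis .
qed

lemma mat_mult_component [simp]: "(mat c ** A) $ i $ j = c * A $ i $ j"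
  for A :: "'a::comm_semiring_1 ^ 'm ^ 'k"
  by (simp add: matrix_matrix_mult_def mat_def if_distrib[of "\<lambda>x. x * _"] cong: if_cong)

lemma mult_mat_component [simp]: "(A ** mat c) $ i $ j = A $ i $ j * c"
  for A :: "'a::comm_semiring_1 ^ 'm ^ 'k"
  by (simp add: matrix_matrix_mult_def mat_def if_distrib[of "\<lambda>x. _ * x"] cong: if_cong)

lemma mat_mult_commute: "mat c ** A = A ** mat c"
  for A :: "'a::comm_semiring_1 ^ 'm ^ 'm"
  by (simp add: vec_eq_iff mult.commute)

lemma mat_mult_left_commute: "A ** (mat c ** B) = mat c ** (A ** B)"
  for A :: "'a::comm_semiring_1 ^ 'm ^ 'm"
  by (metis mat_mult_commute matrix_mul_assoc)

lemma unitary_matrixI: "adj_matrix A ** A = mat 1 \<Longrightarrow> unitary_matrix A"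
  by (simp add: unitary_matrix_def matrix_left_right_inverse[symmetric])

lemma unitary_matrix_mult:
  assumes "unitary_matrix A" "unitary_matrix B"
  shows "unitary_matrix (A ** B)"
proof (rule unitary_matrixI)
  have "adj_matrix (A ** B) ** (A ** B) = adj_matrix B ** (adj_matrix A ** A) ** B"
    by (simp add: adj_matrix_mult matrix_mul_assoc)
  then show "adj_matrix (A ** B) ** (A ** B) = mat 1"
    using assms by (simp add: unitary_matrix_def)
qed

lemma unitary_matrix_mat: "norm c = 1 \<Longrightarrow> unitary_matrix (mat c)"
  by (rule unitary_matrixI) (simp add: vec_eq_iff, simp add: mat_def complex_norm_square[symmetric] mult.commute)

lemma norm_det_unitary_matrix:
  assumes "unitary_matrix A"
  shows "norm (det A) = 1"
proof -
  have "cnj (det A) * det A = 1"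
    using assms by (metis det_I det_adj_matrix det_mul unitary_matrix_def)
  then have "complex_of_real ((norm (det A))\<^sup>2) = of_real 1"
    unfolding complex_norm_square by (simp add: mult.commute)
  then have "(norm (det A))\<^sup>2 = 1"
    by (simp only: of_real_eq_iff)
  then show ?thesis
    by (simp add: power2_eq_1_iff)
      (metis norm_ge_zero not_one_le_zero neg_0_le_iff_le)
qed

lemma norm_vec_square: "complex_of_real ((norm v)\<^sup>2) = (\<Sum>i\<in>UNIV. cnj (v $ i) * v $ i)"
  by (simp add: norm_vec_def L2_set_def sum_nonneg complex_norm_square mult.commute del: of_real_power)

text \<open>The Hermitian form is spelled out as a sum because \<open>inner\<close> on complex
  vectors is real-valued.\<close>

lemma adj_matrix_inner:
  "(\<Sum>i\<in>UNIV. cnj (u $ i) * (A *v v) $ i) = (\<Sum>j\<in>UNIV. cnj ((adj_matrix A *v u) $ j) * v $ j)"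
proof -
  have "(\<Sum>i\<in>UNIV. cnj (u $ i) * (A *v v) $ i) = (\<Sum>i\<in>UNIV. \<Sum>j\<in>UNIV. cnj (u $ i) * A $ i $ j * v $ j)"
    by (simp add: matrix_vector_mult_def sum_distrib_left mult.assoc)
  also have "\<dots> = (\<Sum>j\<in>UNIV. \<Sum>i\<in>UNIV. cnj (u $ i) * A $ i $ j * v $ j)"
    by (rule sum.swap)
  also have "\<dots> = (\<Sum>j\<in>UNIV. cnj ((adj_matrix A *v u) $ j) * v $ j)"
    by (simp add: matrix_vector_mult_def adj_matrix_def sum_distrib_left mult.commute)
  finally show ?thesis .
qed

lemma norm_unitary_matrix_vector:
  assumes "unitary_matrix A"
  shows "norm (A *v v) = norm v"
proof -
  have "complex_of_real ((norm (A *v v))\<^sup>2) = of_real ((norm v)\<^sup>2)"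
    unfolding norm_vec_square adj_matrix_inner
    using assms by (simp add: matrix_vector_mul_assoc unitary_matrix_def)
  then have "(norm (A *v v))\<^sup>2 = (norm v)\<^sup>2"
    by (simp only: of_real_eq_iff)
  then show ?thesis
    by simp
qed

lemma mat_vector_mult: "mat c *v v = c *s v"
  for v :: "'a::comm_semiring_1 ^ 'm"
  by (simp add: vec_eq_iff matrix_vector_mult_def mat_def if_distrib[of "\<lambda>x. x * _"] cong: if_cong)

lemma matrix_add_rdistrib: "(A + B) ** C = A ** C + B ** C"
  by (simp add: matrix_matrix_mult_def vec_eq_iff sum.distrib distrib_right)

lemma
  fixes A :: "complex ^ 'm ^ 'm"
  assumes "det A \<noteq> 0"
  shows matrix_mult_matrix_inv: "A ** matrix_inv A = mat 1"
    and matrix_inv_matrix_mult: "matrix_inv A ** A = mat 1"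
proof -
  have "A ** matrix_inv A = mat 1 \<and> matrix_inv A ** A = mat 1"
    using assms unfolding matrix_inv_def invertible_det_nz[symmetric] invertible_def by (rule someI_ex)
  then show "A ** matrix_inv A = mat 1" "matrix_inv A ** A = mat 1"
    by simp_all
qed

lemma diagonal_matrix_vector_component:
  assumes "diagonal_matrix D"
  shows "(D *v c) $ i = D $ i $ i * c $ i"
proof -
  have "(D *v c) $ i = (\<Sum>j\<in>UNIV. if j = i then D $ i $ i * c $ i else 0)"
    unfolding matrix_vector_mult_def vec_lambda_beta
    using assms by (intro sum.cong) (auto simp: diagonal_matrix_def)
  then show ?thesis by simp
qed

text \<open>A kernel vector \<open>v\<close> satisfies \<open>a *s v = - (b *s (A *v v))\<close>. As
  \<open>A\<close> preserves norms, \<open>norm a * norm v = norm b * norm v\<close>, which forces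
  \<open>v = 0\<close>.\<close>

lemma det_mat_plus_unitary_neq_0:
  fixes A :: "complex ^ 'm ^ 'm"
  assumes "unitary_matrix A" "norm a \<noteq> norm b"
  shows "det (mat a + mat b ** A) \<noteq> 0"
proof -
  have "v = 0" if v: "(mat a + mat b ** A) *v v = 0" for v
  proof -
    have "a *s v = - (b *s (A *v v))"
      using v by (simp add: matrix_vector_mult_add_rdistrib matrix_vector_mul_assoc[symmetric]
          mat_vector_mult eq_neg_iff_add_eq_0)
    then have "norm (a *s v) = norm (b *s (A *v v))"
      by (simp add: norm_minus_cancel)
    moreover have "norm (c *s w) = norm c * norm w" for c and w :: "complex ^ 'm"
      by (simp add: norm_vec_def norm_mult L2_set_right_distrib)
    ultimately have "norm a * norm v = norm b * norm v"
      using assms(1) by (simp add: norm_unitary_matrix_vector)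
    then show ?thesis
      using assms(2) by simp
  qed
  then have "\<exists>B. B ** (mat a + mat b ** A) = mat 1"
    by (simp add: matrix_left_invertible_ker)
  then have "invertible (mat a + mat b ** A)"
    by (simp add: invertible_left_inverse)
  then show ?thesis
    by (simp add: invertible_det_nz)
qed

lemma finite_det_mat_plus_unitary_eq_0:
  assumes "unitary_matrix A"
  shows "finite {z. det (mat z + A) = 0}"
proof -
  \<comment> \<open>The Leibniz expansion of \<open>det (mat z + A)\<close>, with the entries of
    \<open>mat z + A\<close> as linear polynomials in \<open>z\<close>.\<close>
  define p where "p = (\<Sum>\<pi> | \<pi> permutes (UNIV :: 'a set).
    [:of_int (sign \<pi>):] * (\<Prod>i\<in>UNIV. [:A $ i $ \<pi> i, if i = \<pi> i then 1 else 0:]))"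
  have p: "poly p z = det (mat z + A)" for z
    by (simp add: p_def det_def poly_sum poly_prod mat_def)
      (intro sum.cong prod.cong arg_cong[of _ _ "\<lambda>x. _ * x"] refl, auto)
  \<comment> \<open>At \<open>z = 0\<close> the matrix is \<open>A\<close> itself: the case
    \<open>a = 0\<close>, \<open>b = 1\<close> of the preceding lemma.\<close>
  have "poly p 0 \<noteq> 0"
    using det_mat_plus_unitary_neq_0[OF assms, of 0 1] by (simp add: p)
  then have "p \<noteq> 0"
    by auto
  then show ?thesis
    using poly_roots_finite[of p] by (simp add: p)
qed

section \<open>Continuity of determinants, products and inverses\<close>

lemma continuous_on_det [continuous_intros]:
  fixes f :: "'a::topological_space \<Rightarrow> complex ^ 'm ^ 'm"
  assumes "continuous_on S f"
  shows "continuous_on S (\<lambda>x. det (f x))"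
  unfolding det_def by (intro continuous_intros assms)

lemma continuous_on_matrix_mult [continuous_intros]:
  fixes f :: "'a::topological_space \<Rightarrow> complex ^ 'm ^ 'k" and g :: "'a \<Rightarrow> complex ^ 'l ^ 'm"
  assumes "continuous_on S f" "continuous_on S g"
  shows "continuous_on S (\<lambda>x. f x ** g x)"
  unfolding matrix_matrix_mult_def by (intro continuous_intros assms)

lemma continuous_on_mat [continuous_intros]:
  fixes f :: "'a::topological_space \<Rightarrow> complex"
  assumes "continuous_on S f"
  shows "continuous_on S (\<lambda>x. mat (f x) :: complex ^ 'm ^ 'm)"
proof -
  have "continuous_on S (\<lambda>x. if i = j then f x else 0)" for i j :: 'm
    using assms by (cases "i = j") auto
  then show ?thesis
    unfolding mat_def by (intro continuous_intros)
qed

text \<open>Cramer's rule for each column of the identity. It exhibits the entries of the inverse as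
  quotients of determinants, from which continuity of inversion can be read off.\<close>

lemma matrix_inv_cramer:
  fixes A :: "complex ^ 'm ^ 'm"
  assumes "det A \<noteq> 0"
  shows "matrix_inv A = (\<chi> k l. det (\<chi> i j. if j = k then axis l 1 $ i else A $ i $ j) / det A)"
proof -
  have "A ** matrix_inv A = mat 1"
    using assms by (rule matrix_mult_matrix_inv)
  then have "A *v (\<chi> k. matrix_inv A $ k $ l) = axis l 1" for l
    by (auto simp: matrix_matrix_mult_def matrix_vector_mult_def vec_eq_iff mat_def axis_def)
  then have "(\<chi> k. matrix_inv A $ k $ l) =
      (\<chi> k. det (\<chi> i j. if j = k then axis l 1 $ i else A $ i $ j) / det A)" for l
    using cramer[OF assms] by blast
  then show ?thesis
    by (simp add: vec_eq_iff)
qed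

lemma continuous_on_matrix_inv:
  fixes f :: "'a::topological_space \<Rightarrow> complex ^ 'm ^ 'm"
  assumes "continuous_on S f" "\<And>x. x \<in> S \<Longrightarrow> det (f x) \<noteq> 0"
  shows "continuous_on S (\<lambda>x. matrix_inv (f x))"
proof -
  have c: "continuous_on S (\<lambda>x. if j = k then axis l 1 $ i else f x $ i $ j)" for i j k l :: 'm
    using assms by (cases "j = k") (auto intro!: continuous_intros)
  have "continuous_on S (\<lambda>x. \<chi> k l. det (\<chi> i j. if j = k then axis l 1 $ i else f x $ i $ j) / det (f x))"
    using assms c by (intro continuous_intros) auto
  then show ?thesis
    by (rule continuous_on_eq) (simp add: matrix_inv_cramer assms)
qed

section \<open>Path connectedness of the unitary commutant\<close>

definition U_commutant :: "(complex ^ 'm ^ 'm) set \<Rightarrow> (complex ^ 'm ^ 'm) set" where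
  "U_commutant M = {A. unitary_matrix A \<and> (\<forall>B\<in>M. A ** B = B ** A)}"

text \<open>
  The transformation \<open>z \<mapsto> (z + c) / (1 + cnj c * z)\<close> preserves the unit circle. It is the identity
  for \<open>c = 0\<close> and the constant \<open>c\<close> for \<open>norm c = 1\<close>.
\<close>

definition moebius_matrix :: "complex ^ 'm ^ 'm \<Rightarrow> complex \<Rightarrow> complex ^ 'm ^ 'm" where
  "moebius_matrix A c = (mat c + A) ** matrix_inv (mat 1 + mat (cnj c) ** A)"

text \<open>For numerator \<open>X\<close> and denominator \<open>Y\<close>, unitarity of
  \<open>A\<close> gives \<open>adj_matrix X ** X = adj_matrix Y ** Y\<close>, the matrix form of
  \<open>norm (z + c) = norm (1 + cnj c * z)\<close> on the unit circle. Hence \<open>X\<close>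
  times the inverse of \<open>Y\<close> is unitary.\<close>

lemma unitary_moebius_matrix:
  fixes A :: "complex ^ 'm ^ 'm"
  assumes A: "unitary_matrix A" and "det (mat 1 + mat (cnj c) ** A) \<noteq> 0"
  shows "unitary_matrix (moebius_matrix A c)"
proof -
  define X where "X = mat c + A"
  define Y where "Y = mat 1 + mat (cnj c) ** A"
  define Z where "Z = matrix_inv Y"
  have YZ: "Y ** Z = mat 1"
    unfolding Y_def Z_def by (rule matrix_mult_matrix_inv[OF assms(2)])
  have AA: "adj_matrix A ** A = mat 1"
    using A by (simp add: unitary_matrix_def)
  have "adj_matrix X ** X = mat (cnj c) ** mat c + mat (cnj c) ** A + adj_matrix A ** mat c + mat 1"
    by (simp add: X_def adj_matrix_add matrix_add_ldistrib matrix_add_rdistrib AA add.assoc)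
  moreover have "adj_matrix Y ** Y =
      mat 1 + mat (cnj c) ** A + adj_matrix A ** mat c + adj_matrix A ** mat c ** mat (cnj c) ** A"
    by (simp add: Y_def adj_matrix_add adj_matrix_mult matrix_add_ldistrib matrix_add_rdistrib
        add.assoc matrix_mul_assoc)
  moreover have "adj_matrix A ** mat c ** mat (cnj c) ** A = mat (cnj c) ** mat c"
  proof -
    have mm: "mat a ** mat b = (mat (a * b) :: complex ^ 'm ^ 'm)" for a b
      by (auto simp: vec_eq_iff) (auto simp: mat_def)
    have "adj_matrix A ** mat c ** mat (cnj c) ** A = adj_matrix A ** (mat (c * cnj c) ** A)"
      by (simp flip: mm matrix_mul_assoc)
    also have "\<dots> = mat (c * cnj c)"
      by (simp add: mat_mult_left_commute AA)
    finally show ?thesis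
      by (simp add: mm mult.commute)
  qed
  ultimately have XY: "adj_matrix X ** X = adj_matrix Y ** Y"
    by (simp add: algebra_simps)
  have "adj_matrix (X ** Z) ** (X ** Z) = adj_matrix Z ** (adj_matrix X ** X) ** Z"
    by (simp add: adj_matrix_mult matrix_mul_assoc)
  also have "\<dots> = adj_matrix (Y ** Z) ** (Y ** Z)"
    by (simp add: XY adj_matrix_mult matrix_mul_assoc)
  also have "\<dots> = mat 1"
    by (simp add: YZ)
  finally have "unitary_matrix (X ** Z)"
    by (rule unitary_matrixI)
  then show ?thesis
    by (simp add: moebius_matrix_def X_def Y_def Z_def)
qed

lemma matrix_inv_commute:
  fixes A B :: "complex ^ 'm ^ 'm"
  assumes "det A \<noteq> 0" "A ** B = B ** A"
  shows "matrix_inv A ** B = B ** matrix_inv A"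
proof -
  have A: "A ** matrix_inv A = mat 1" "matrix_inv A ** A = mat 1"
    using assms by (simp_all add: matrix_mult_matrix_inv matrix_inv_matrix_mult)
  have "matrix_inv A ** B = matrix_inv A ** (B ** A) ** matrix_inv A"
    by (simp add: A(1) matrix_mul_assoc[symmetric])
  also have "\<dots> = B ** matrix_inv A"
    by (simp add: A assms(2)[symmetric] matrix_mul_assoc)
  finally show ?thesis .
qed

lemma moebius_matrix_in_U_commutant:
  assumes "A \<in> U_commutant M" "det (mat 1 + mat (cnj c) ** A) \<noteq> 0"
  shows "moebius_matrix A c \<in> U_commutant M"
proof -
  have "moebius_matrix A c ** B = B ** moebius_matrix A c" if "B \<in> M" for B
  proof -
    have AB: "A ** B = B ** A"
      using assms that by (simp add: U_commutant_def)
    let ?Y = "mat 1 + mat (cnj c) ** A"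
    have Y: "?Y ** B = B ** ?Y"
      by (simp add: matrix_add_ldistrib matrix_add_rdistrib mat_mult_left_commute AB
          flip: matrix_mul_assoc)
    have X: "(mat c + A) ** B = B ** (mat c + A)"
      by (simp add: matrix_add_ldistrib matrix_add_rdistrib mat_mult_commute AB)
    show ?thesis
      unfolding moebius_matrix_def
      by (metis X matrix_inv_commute[OF assms(2) Y] matrix_mul_assoc)
  qed
  then show ?thesis
    using assms by (simp add: U_commutant_def unitary_moebius_matrix)
qed

lemma mat_in_U_commutant: "norm c = 1 \<Longrightarrow> mat c \<in> U_commutant M"
  by (simp add: U_commutant_def unitary_matrix_mat mat_mult_commute)

lemma path_component_U_commutant_mat:
  fixes A :: "complex ^ 'm ^ 'm"
  assumes A: "A \<in> U_commutant M"
  shows "\<exists>c. norm c = 1 \<and> path_component (U_commutant M) A (mat c)"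
proof -
  have U: "unitary_matrix A"
    using A by (simp add: U_commutant_def)
  \<comment> \<open>Only finitely many \<open>z\<close> make \<open>mat z + A\<close> singular, so
    the infinite unit circle contains a \<open>c\<close> that does not.\<close>
  have "infinite (sphere (0::complex) 1)"
    by (metis DIM_complex connected_sphere connected_uncountable countable_finite dual_order.refl
        mem_sphere dist_0_norm norm_one norm_minus_cancel one_neq_neg_one)
  then obtain c where c: "norm c = 1" "det (mat c + A) \<noteq> 0"
    using finite_det_mat_plus_unitary_eq_0[OF U] rev_finite_subset[of "{z. det (mat z + A) = 0}" "sphere 0 1"]
    by fastforce
  have cc: "cnj c * c = 1"
    using c by (metis complex_norm_square mult.commute of_real_1 power_one)
  \<comment> \<open>At the end \<open>t = 1\<close> of the path, the denominator is invertible by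
    the choice of \<open>c\<close>. For \<open>t < 1\<close> it is invertible because
    \<open>norm (t *\<^sub>R c) < 1\<close>.\<close>
  have Y1: "mat 1 + mat (cnj c) ** A = mat (cnj c) ** (mat c + A)"
    by (simp add: vec_eq_iff matrix_add_ldistrib) (simp add: mat_def cc)
  have det_mat: "det (mat (cnj c) :: complex ^ 'm ^ 'm) \<noteq> 0"
    using norm_det_unitary_matrix[OF unitary_matrix_mat, of "cnj c", where 'a = 'm] c by auto
  have det: "det (mat 1 + mat (cnj (t *\<^sub>R c)) ** A) \<noteq> 0" if "t \<in> {0..1}" for t :: real
  proof (cases "t = 1")
    case True
    then show ?thesis
      using c det_mat by (simp add: Y1 det_mul)
  next
    case False
    then show ?thesis
      using det_mat_plus_unitary_neq_0[OF U, of 1 "cnj (t *\<^sub>R c)"] c that by simp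
  qed
  define g where "g t = moebius_matrix A (t *\<^sub>R c)" for t :: real
  have "path g"
    unfolding path_def g_def moebius_matrix_def
    by (intro continuous_intros continuous_on_matrix_inv det) auto
  moreover have "path_image g \<subseteq> U_commutant M"
    unfolding path_image_def g_def using moebius_matrix_in_U_commutant[OF A det] by blast
  moreover have "pathstart g = A"
  proof -
    have "mat 0 = (0 :: complex ^ 'm ^ 'm)"
      by (simp add: mat_def vec_eq_iff)
    moreover have "matrix_inv (mat 1) = (mat 1 :: complex ^ 'm ^ 'm)"
      using matrix_mult_matrix_inv[of "mat 1 :: complex ^ 'm ^ 'm"] by (simp add: det_I)
    ultimately show ?thesis
      by (simp add: pathstart_def g_def moebius_matrix_def)
  qed
  moreover have "pathfinish g = mat c"
  proof -
    let ?Y = "mat 1 + mat (cnj c) ** A"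
    \<comment> \<open>For \<open>c\<close> of modulus one the numerator is \<open>c\<close> times
      the denominator, so the quotient is scalar.\<close>
    have "mat c + A = mat c ** ?Y"
      using cc by (simp add: Y1 vec_eq_iff mult.assoc[symmetric] mult.commute)
    moreover have "?Y ** matrix_inv ?Y = mat 1"
      using det[of 1] by (intro matrix_mult_matrix_inv) simp
    ultimately have "moebius_matrix A c = mat c"
      unfolding moebius_matrix_def by (metis matrix_mul_assoc matrix_mul_rid)
    then show ?thesis
      by (simp add: pathfinish_def g_def)
  qed
  ultimately show ?thesis
    using c(1) unfolding path_component_def by blast
qed

lemma path_connected_U_commutant:
  fixes M :: "(complex ^ 'm ^ 'm) set"
  shows "path_connected (U_commutant M)"
proof -
  \<comment> \<open>The scalars of modulus one form a circle inside the commutant and so join all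
    the end points to \<open>mat 1\<close>.\<close>
  have "path_connected ((mat :: complex \<Rightarrow> complex ^ 'm ^ 'm) ` sphere 0 1)"
    by (intro path_connected_continuous_image path_connected_sphere continuous_intros) simp
  then have phase: "path_component (U_commutant M) (mat c) (mat 1)" if "norm c = 1" for c
    using that path_component_of_subset[of "mat ` sphere 0 1" "U_commutant M" "mat c" "mat 1"]
    by (fastforce simp: path_connected_component mat_in_U_commutant)
  have "path_component (U_commutant M) A (mat 1)" if "A \<in> U_commutant M" for A
    using path_component_U_commutant_mat[OF that] phase path_component_trans by blast
  then show ?thesis
    unfolding path_connected_component by (meson path_component_sym path_component_trans)
qed

section \<open>Multiplication by a phase on one line\<close>

text \<open>For a unit vector \<open>v\<close>, this is \<open>1 + (z - 1) P\<close> with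
  \<open>P\<close> the orthogonal projection onto the line of \<open>v\<close>: it multiplies
  \<open>v\<close> by \<open>z\<close> and fixes the orthogonal complement.\<close>

definition phase_matrix :: "complex ^ 'm \<Rightarrow> complex \<Rightarrow> complex ^ 'm ^ 'm" where
  "phase_matrix v z = (\<chi> i j. (if i = j then 1 else 0) + (z - 1) * v $ i * cnj (v $ j))"

lemma phase_matrix_1 [simp]: "phase_matrix v 1 = mat 1"
  by (simp add: phase_matrix_def mat_def)

lemma adj_phase_matrix: "adj_matrix (phase_matrix v z) = phase_matrix v (cnj z)"
  by (auto simp: phase_matrix_def adj_matrix_def vec_eq_iff)

lemma matrix_mult_phase_matrix_component:
  "(A ** phase_matrix v z) $ i $ j = A $ i $ j + (z - 1) * (A *v v) $ i * cnj (v $ j)"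
  by (simp add: phase_matrix_def matrix_matrix_mult_def matrix_vector_mult_def distrib_left
      sum.distrib sum_distrib_left sum_distrib_right mult_ac if_distrib[of "\<lambda>x. _ * x"] cong: if_cong)

text \<open>The row vector obtained by multiplying the adjoint of \<open>v\<close> by
  \<open>A\<close> is the adjoint of \<open>adj_matrix A *v v\<close>. This is how the adjoint
  enters the commutation condition.\<close>

lemma phase_matrix_mult_component:
  "(phase_matrix v z ** A) $ i $ j = A $ i $ j + (z - 1) * v $ i * cnj ((adj_matrix A *v v) $ j)"
proof -
  have "(phase_matrix v z ** A) $ i $ j =
      (\<Sum>k\<in>UNIV. (if k = i then A $ i $ j else 0) + (z - 1) * v $ i * (cnj (v $ k) * A $ k $ j))"
    unfolding matrix_matrix_mult_def vec_lambda_beta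
    by (intro sum.cong) (auto simp: phase_matrix_def algebra_simps)
  also have "\<dots> = A $ i $ j + (z - 1) * v $ i * (\<Sum>k\<in>UNIV. cnj (v $ k) * A $ k $ j)"
    by (simp add: sum.distrib sum_distrib_left)
  finally show ?thesis
    by (simp add: matrix_vector_mult_def adj_matrix_def mult.commute)
qed

lemma phase_matrix_vector:
  assumes "norm v = 1"
  shows "phase_matrix v z *v v = z *s v"
proof -
  have "(\<Sum>j\<in>UNIV. cnj (v $ j) * v $ j) = 1"
    using norm_vec_square[of v] assms by simp
  then have "(\<Sum>j\<in>UNIV. (z - 1) * v $ i * (cnj (v $ j) * v $ j)) = (z - 1) * v $ i" for i
    by (simp flip: sum_distrib_left)
  then show ?thesis
    by (simp add: phase_matrix_def matrix_vector_mult_def vec_eq_iff distrib_right mult.assoc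
        sum.distrib if_distrib[of "\<lambda>x. x * _"] cong: if_cong) (simp add: algebra_simps)
qed

lemma unitary_phase_matrix:
  assumes "norm v = 1" "norm z = 1"
  shows "unitary_matrix (phase_matrix v z)"
proof (rule unitary_matrixI)
  have "cnj z * z = 1"
    using assms by (metis complex_norm_square mult.commute of_real_1 power_one)
  then show "adj_matrix (phase_matrix v z) ** phase_matrix v z = mat 1"
    using assms(1)
    by (auto simp: vec_eq_iff matrix_mult_phase_matrix_component adj_phase_matrix phase_matrix_vector)
      (auto simp: phase_matrix_def mat_def algebra_simps)
qed

text \<open>Cramer's lemma for the identity matrix.\<close>

lemma det_replace_column_mat_1:
  "det (\<chi> i j. if j = k then x $ i else if i = j then 1 else 0) = (x $ k :: complex)"
proof -
  have "(\<chi> i j. if j = k then x $ i else if i = j then 1 else 0) =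
      (\<chi> i j. if j = k then (mat 1 *v x) $ i else mat 1 $ i $ j)"
    unfolding matrix_vector_mul_lid vec_eq_iff by (auto simp: mat_def)
  then show ?thesis
    using cramer_lemma[of k "mat 1" x] by (simp only: det_I mult_1_right)
qed

text \<open>A change of basis makes the matrix differ from the identity in a single row, where the
  determinant is the diagonal entry.\<close>

lemma det_phase_matrix:
  fixes v :: "complex ^ 'm"
  assumes "norm v = 1"
  shows "det (phase_matrix v z) = z"
proof -
  have "v \<noteq> 0"
    using assms by auto
  then obtain k where k: "v $ k \<noteq> 0"
    by (auto simp: vec_eq_iff)
  \<comment> \<open>The columns of \<open>S\<close> are the standard basis with the
    \<open>k\<close>-th vector replaced by \<open>v\<close>; they form a basis as
    \<open>v $ k\<close> is nonzero. In it the phase matrix becomes \<open>T\<close>: it sends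
    \<open>v\<close> to \<open>z *s v\<close>, and adds \<open>(z - 1) * cnj (v $ j)\<close> times
    \<open>v\<close> to the \<open>j\<close>-th basis vector for
    \<open>j \<noteq> k\<close>.\<close>
  define S :: "complex ^ 'm ^ 'm" where
    "S = (\<chi> i j. if j = k then v $ i else if i = j then 1 else 0)"
  define x where "x = (\<chi> j. if j = k then z else (z - 1) * cnj (v $ j))"
  define T :: "complex ^ 'm ^ 'm" where
    "T = (\<chi> i j. if i = k then x $ j else if i = j then 1 else 0)"
  have "(phase_matrix v z ** S) $ i $ j = (S ** T) $ i $ j" for i j
  proof (cases "j = k")
    case True
    have "(phase_matrix v z ** S) $ i $ k = (phase_matrix v z *v v) $ i"
      by (simp add: S_def matrix_matrix_mult_def matrix_vector_mult_def)
    moreover have "(S ** T) $ i $ k = (\<Sum>l\<in>UNIV. if l = k then v $ i * z else 0)"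
      unfolding matrix_matrix_mult_def vec_lambda_beta
      by (intro sum.cong) (auto simp: S_def T_def x_def)
    ultimately show ?thesis
      using True assms by (simp add: phase_matrix_vector)
  next
    case False
    have "(phase_matrix v z ** S) $ i $ j = phase_matrix v z $ i $ j"
      using False
      by (simp add: S_def matrix_matrix_mult_def if_distrib[of "\<lambda>x. _ * x"] cong: if_cong)
    moreover have "(S ** T) $ i $ j =
        (\<Sum>l\<in>UNIV. (if l = k then v $ i * x $ j else 0) + (if l = j then if i = j then 1 else 0 else 0))"
      unfolding matrix_matrix_mult_def vec_lambda_beta
      using False by (intro sum.cong) (auto simp: S_def T_def)
    ultimately show ?thesis
      using False by (simp add: phase_matrix_def x_def sum.distrib)
  qed
  then have "phase_matrix v z ** S = S ** T"
    by (simp add: vec_eq_iff)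
  then have "det (phase_matrix v z) * det S = det S * det T"
    by (metis det_mul)
  moreover have "det S = v $ k"
    by (simp add: S_def det_replace_column_mat_1)
  moreover have "det T = z"
  proof -
    have "transpose T = (\<chi> i j. if j = k then x $ i else if i = j then 1 else 0)"
      by (auto simp: T_def transpose_def vec_eq_iff)
    then have "det (transpose T) = x $ k"
      by (simp add: det_replace_column_mat_1)
    then show ?thesis
      by (simp add: det_transpose x_def)
  qed
  ultimately show ?thesis
    using k by simp
qed

text \<open>Both products differ from \<open>B\<close> by \<open>(z - 1) * \<mu>\<close> times the
  rank one matrix with entries \<open>v $ i * cnj (v $ j)\<close>.\<close>

lemma phase_matrix_commute:
  assumes "B *v v = \<mu> *s v" "adj_matrix B *v v = cnj \<mu> *s v"
  shows "phase_matrix v z ** B = B ** phase_matrix v z"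
  by (simp add: vec_eq_iff matrix_mult_phase_matrix_component phase_matrix_mult_component assms)

section \<open>From the unitary to the special unitary commutant\<close>

lemma connected_SU_commutant:
  fixes M :: "(complex ^ 'm ^ 'm) set"
  assumes v: "norm v = 1"
    and M: "\<And>B. B \<in> M \<Longrightarrow> \<exists>\<mu>. B *v v = \<mu> *s v \<and> adj_matrix B *v v = cnj \<mu> *s v"
  shows "connected (SU_commutant M)"
proof -
  \<comment> \<open>The determinant of \<open>A\<close> has modulus one, so its conjugate is its
    inverse and the phase factor corrects the determinant to \<open>1\<close>.\<close>
  define r where "r A = A ** phase_matrix v (cnj (det A))" for A :: "complex ^ 'm ^ 'm"
  have r1: "r A \<in> SU_commutant M" if A: "A \<in> U_commutant M" for A
  proof -
    have U: "unitary_matrix A"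
      using A by (simp add: U_commutant_def)
    have d: "norm (det A) = 1"
      by (rule norm_det_unitary_matrix[OF U])
    then have "det A * cnj (det A) = 1"
      by (metis complex_norm_square of_real_1 power_one)
    then have "det (r A) = 1"
      by (simp add: r_def det_mul det_phase_matrix v)
    moreover have "unitary_matrix (r A)"
      using U d v by (simp add: r_def unitary_matrix_mult unitary_phase_matrix)
    moreover have "r A ** B = B ** r A" if B: "B \<in> M" for B
    proof -
      have "phase_matrix v z ** B = B ** phase_matrix v z" for z
        using M[OF B] phase_matrix_commute by blast
      moreover have "A ** B = B ** A"
        using A B by (simp add: U_commutant_def)
      ultimately show ?thesis
        unfolding r_def by (metis matrix_mul_assoc)
    qed
    ultimately show ?thesis
      by (simp add: SU_commutant_def SU_def)
  qed
  have r2: "A \<in> r ` U_commutant M" if A: "A \<in> SU_commutant M" for A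
  proof (rule image_eqI)
    \<comment> \<open>For determinant one the phase factor is \<open>phase_matrix v 1\<close>, the
      identity.\<close>
    show "A = r A"
      using A by (simp add: r_def SU_commutant_def SU_def)
    show "A \<in> U_commutant M"
      using A by (simp add: SU_commutant_def SU_def U_commutant_def)
  qed
  have "continuous_on (U_commutant M) r"
    unfolding r_def phase_matrix_def by (intro continuous_intros)
  then have "connected (r ` U_commutant M)"
    by (intro connected_continuous_image path_connected_imp_connected path_connected_U_commutant)
  moreover have "r ` U_commutant M = SU_commutant M"
    using r1 r2 by blast
  ultimately show ?thesis
    by simp
qed

section \<open>Common eigenvectors of commuting normal matrices\<close>

text \<open>In the coordinates \<open>c\<close> of \<open>v\<close> in a unitary eigenbasis, the
  diagonal entry of \<open>D\<close> is \<open>\<mu>\<close> wherever \<open>c\<close> is nonzero.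
  The adjoint has the conjugate entries in the same basis.\<close>

lemma adj_eigenvector:
  assumes "unitarily_diagonalizable B" "B *v v = \<mu> *s v"
  shows "adj_matrix B *v v = cnj \<mu> *s v"
proof -
  obtain V D where V: "unitary_matrix V" and D: "diagonal_matrix D" and B: "B = V ** D ** adj_matrix V"
    using assms(1) by (auto simp: unitarily_diagonalizable_def)
  define c where "c = adj_matrix V *v v"
  have v: "v = V *v c"
    using V by (simp add: c_def matrix_vector_mul_assoc unitary_matrix_def)
  have "D *v c = adj_matrix V *v (B *v v)"
    using V by (simp add: B c_def matrix_vector_mul_assoc matrix_mul_assoc unitary_matrix_def)
  also have "\<dots> = \<mu> *s c"
    by (simp add: assms(2) c_def vector_scalar_commute)
  finally have "D $ i $ i * c $ i = \<mu> * c $ i" for i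
    using diagonal_matrix_vector_component[OF D] by (metis vector_smult_component)
  moreover have "diagonal_matrix (adj_matrix D)"
    using D by (auto simp: diagonal_matrix_def adj_matrix_def)
  ultimately have "adj_matrix D *v c = cnj \<mu> *s c"
    by (auto simp: vec_eq_iff diagonal_matrix_vector_component) (auto simp: adj_matrix_def simp flip: complex_cnj_mult)
  moreover have "adj_matrix B *v v = V *v (adj_matrix D *v c)"
    by (simp add: B c_def adj_matrix_mult matrix_vector_mul_assoc matrix_mul_assoc)
  ultimately show ?thesis
    by (simp add: v vector_scalar_commute)
qed

text \<open>
  Among the nonzero vectors of the invariant subspace, one with the fewest nonzero coordinates in an
  eigenbasis is an eigenvector.
\<close>

lemma eigenvector_in_invariant_subspace:
  fixes B :: "complex ^ 'm ^ 'm"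
  assumes "unitarily_diagonalizable B" and W: "vec.subspace W" "W \<noteq> {0}"
    and inv: "\<And>w. w \<in> W \<Longrightarrow> B *v w \<in> W"
  shows "\<exists>w\<in>W. w \<noteq> 0 \<and> (\<exists>\<mu>. B *v w = \<mu> *s w)"
proof -
  obtain V D where V: "unitary_matrix V" and D: "diagonal_matrix D" and B: "B = V ** D ** adj_matrix V"
    using assms(1) by (auto simp: unitarily_diagonalizable_def)
  define c where "c w = adj_matrix V *v w" for w
  define supp where "supp w = {i. c w $ i \<noteq> 0}" for w
  have v: "w = V *v c w" for w
    using V by (simp add: c_def matrix_vector_mul_assoc unitary_matrix_def)
  have cB: "c (B *v w) $ i = D $ i $ i * c w $ i" for w i
  proof -
    have "c (B *v w) = D *v c w"
      using V by (simp add: B c_def matrix_vector_mul_assoc matrix_mul_assoc unitary_matrix_def)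
    then show ?thesis
      by (simp add: diagonal_matrix_vector_component D)
  qed
  obtain w0 where "w0 \<in> W" "w0 \<noteq> 0"
    using W vec.subspace_0 by blast
  then obtain w where w: "w \<in> W" "w \<noteq> 0"
    and min: "\<And>u. u \<in> W \<Longrightarrow> u \<noteq> 0 \<Longrightarrow> card (supp w) \<le> card (supp u)"
    using ex_has_least_nat[of "\<lambda>w. w \<in> W \<and> w \<noteq> 0" w0 "\<lambda>w. card (supp w)"] by blast
  have "c w \<noteq> 0"
    using v[of w] w(2) by (metis matrix_vector_mult_0_right)
  then obtain i where i: "c w $ i \<noteq> 0"
    by (auto simp: vec_eq_iff)
  \<comment> \<open>Subtracting \<open>D $ i $ i *s w\<close> cancels coordinate \<open>i\<close>
    and makes no zero coordinate nonzero, so minimality of the support forces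
    \<open>u = 0\<close>.\<close>
  define u where "u = B *v w - D $ i $ i *s w"
  have cu: "c u $ j = (D $ j $ j - D $ i $ i) * c w $ j" for j
  proof -
    have "c u = c (B *v w) - D $ i $ i *s c w"
      by (simp add: u_def c_def matrix_vector_mult_diff_distrib vector_scalar_commute)
    then show ?thesis
      by (simp add: cB left_diff_distrib)
  qed
  then have "supp u \<subseteq> supp w - {i}"
    by (auto simp: supp_def)
  then have "card (supp u) < card (supp w)"
    using i by (intro psubset_card_mono) (auto simp: supp_def)
  moreover have "u \<in> W"
    using W w inv by (simp add: u_def vec.subspace_diff vec.subspace_scale)
  ultimately have "u = 0"
    using min[of u] by fastforce
  then show ?thesis
    using w unfolding u_def by (metis eq_iff_diff_eq_0)
qed

text \<open>In a nonzero \<open>M\<close>-invariant subspace of least dimension, an eigenspace of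
  any \<open>B\<close> in \<open>M\<close> is again invariant by commutativity, hence is the whole
  subspace. So all of \<open>M\<close> acts there by scalars. Taking a minimum of dimensions also
  covers infinite \<open>M\<close>.\<close>

lemma common_eigenvector:
  fixes M :: "(complex ^ 'm ^ 'm) set"
  assumes diag: "\<And>B. B \<in> M \<Longrightarrow> unitarily_diagonalizable B"
    and comm: "\<And>A B. A \<in> M \<Longrightarrow> B \<in> M \<Longrightarrow> A ** B = B ** A"
  shows "\<exists>v. norm v = 1 \<and> (\<forall>B\<in>M. \<exists>\<mu>. B *v v = \<mu> *s v)"
proof -
  define P where "P W \<longleftrightarrow> vec.subspace W \<and> W \<noteq> {0} \<and> (\<forall>B\<in>M. \<forall>w\<in>W. B *v w \<in> W)"
    for W :: "(complex ^ 'm) set"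
  have "axis undefined 1 \<noteq> (0 :: complex ^ 'm)"
    by (simp add: axis_eq_0_iff)
  then have "P UNIV"
    by (auto simp: P_def)
  then obtain W where W: "P W" and min: "\<And>E. P E \<Longrightarrow> vec.dim W \<le> vec.dim E"
    using ex_has_least_nat[of P UNIV vec.dim] by blast
  have "\<exists>\<mu>. \<forall>w\<in>W. B *v w = \<mu> *s w" if B: "B \<in> M" for B
  proof -
    obtain u \<mu> where u: "u \<in> W" "u \<noteq> 0" "B *v u = \<mu> *s u"
      using eigenvector_in_invariant_subspace[OF diag[OF B], of W] W B by (auto simp: P_def)
    define E where "E = {w \<in> W. B *v w = \<mu> *s w}"
    have "vec.subspace E"
      using W unfolding E_def P_def vec.subspace_def
      by (auto simp: matrix_vector_right_distrib vector_scalar_commute vector_add_ldistrib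
          vector_smult_assoc mult.commute)
    moreover have "A *v w \<in> E" if A: "A \<in> M" and w: "w \<in> E" for A w
    proof -
      have "B *v (A *v w) = A *v (B *v w)"
        using comm[OF A B] by (simp add: matrix_vector_mul_assoc)
      then show ?thesis
        using W A w by (simp add: E_def P_def vector_scalar_commute)
    qed
    ultimately have "P E"
      using u by (auto simp: P_def E_def)
    then have "E = W"
      using min[of E] W by (intro vec.subspace_dim_equal) (auto simp: P_def E_def)
    then show ?thesis
      by (auto simp: E_def)
  qed
  moreover obtain w where w: "w \<in> W" "w \<noteq> 0"
    using W vec.subspace_0 by (auto simp: P_def)
  moreover define v where "v = complex_of_real (1 / norm w) *s w"
  moreover have "v \<in> W"
    using W w by (simp add: v_def P_def vec.subspace_scale)
  \<comment> \<open>Membership in \<open>W\<close> uses complex scaling, the norm real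
    scaling.\<close>
  moreover have "v = (1 / norm w) *\<^sub>R w"
    unfolding v_def vec_eq_iff vector_scaleR_component by (simp add: scaleR_conv_of_real)
  then have "norm v = 1"
    using w by simp
  ultimately show ?thesis
    by blast
qed

section \<open>Qubit permutations and the two cases of the theorem\<close>

lemma
  fixes \<alpha> :: "'n::finite \<Rightarrow> 'n"
  assumes "bij \<alpha>"
  shows qubit_perm_axis: "qubit_perm \<alpha> *v axis (\<lambda>_. k) 1 = axis (\<lambda>_. k) 1"
    and adj_qubit_perm_axis: "adj_matrix (qubit_perm \<alpha>) *v axis (\<lambda>_. k) 1 = axis (\<lambda>_. k) 1"
proof -
  \<comment> \<open>As \<alpha> is surjective, only the constant assignment of states becomes
    constant after permuting the qubits.\<close>
  have [simp]: "s \<circ> \<alpha> = (\<lambda>_. k) \<longleftrightarrow> s = (\<lambda>_. k)" for s :: "'n \<Rightarrow> 2"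
    using assms by (auto simp: fun_eq_iff) (metis bij_pointE)
  then have [simp]: "(\<lambda>_. k) = s \<circ> \<alpha> \<longleftrightarrow> s = (\<lambda>_. k)" for s :: "'n \<Rightarrow> 2"
    by metis
  have [simp]: "(\<lambda>_. k) \<circ> \<alpha> = (\<lambda>_. k)"
    by auto
  show "qubit_perm \<alpha> *v axis (\<lambda>_. k) 1 = axis (\<lambda>_. k) 1"
    by (simp add: matrix_vector_mult_def axis_def qubit_perm_def vec_eq_iff
        if_distrib[of "\<lambda>x. _ * x"] cong: if_cong)
  show "adj_matrix (qubit_perm \<alpha>) *v axis (\<lambda>_. k) 1 = axis (\<lambda>_. k) 1"
    by (simp add: matrix_vector_mult_def axis_def qubit_perm_def adj_matrix_def vec_eq_iff
        if_distrib[of "\<lambda>x. _ * x"] cong: if_cong)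
qed

theorem theorem3p13:
  shows "(\<forall>M :: 'n::finite qmat set.
            (\<forall>A\<in>M. unitarily_diagonalizable A) \<and> (\<forall>A\<in>M. \<forall>B\<in>M. A ** B = B ** A)
            \<longrightarrow> connected (SU_commutant M))
       \<and> (\<forall>G :: ('n \<Rightarrow> 'n) set.
            subgroup G (BijGroup UNIV) \<longrightarrow> connected (SU_commutant (qubit_perm ` G)))"
proof (intro conjI allI impI)
  fix M :: "'n qmat set"
  assume M: "(\<forall>A\<in>M. unitarily_diagonalizable A) \<and> (\<forall>A\<in>M. \<forall>B\<in>M. A ** B = B ** A)"
  then obtain v where "norm v = 1" "\<forall>B\<in>M. \<exists>\<mu>. B *v v = \<mu> *s v"
    using common_eigenvector[of M] by blast
  then show "connected (SU_commutant M)"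
    using M adj_eigenvector by (intro connected_SU_commutant[of v]) blast+
next
  fix G :: "('n \<Rightarrow> 'n) set"
  assume "subgroup G (BijGroup UNIV)"
  then have G: "bij \<alpha>" if "\<alpha> \<in> G" for \<alpha>
    using that subgroup.subset by (fastforce simp: BijGroup_def Bij_def)
  show "connected (SU_commutant (qubit_perm ` G))"
  proof (rule connected_SU_commutant)
    show "norm (axis (\<lambda>_. 0) 1 :: complex ^ ('n \<Rightarrow> 2)) = 1"
      by simp
    fix B :: "'n qmat"
    assume "B \<in> qubit_perm ` G"
    then show "\<exists>\<mu>. B *v axis (\<lambda>_. 0) 1 = \<mu> *s axis (\<lambda>_. 0) 1 \<and>
        adj_matrix B *v axis (\<lambda>_. 0) 1 = cnj \<mu> *s axis (\<lambda>_. 0) 1"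
      \<comment> \<open>The eigenvalue is \<open>1\<close>, its own conjugate.\<close>
      using G by (intro exI[of _ 1]) (auto simp: qubit_perm_axis adj_qubit_perm_axis)
  qed
qed

end
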